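(* Let $(W,S)$ be a Coxeter group and $u\in W$. The sets $[e,u]_L=\{w\in W\mid w\le_L u\}$ and $[e,u]_R=\{w\in W\mid w\le_R u\}$ have the Chain Property: for any $v,w$ in the set with $v\le w$, there is a chain $v=x_0\lessdot x_1\lessdot\cdots\lessdot x_n=w$ of strong covers with every $x_i$ in the set.
   Context: $\le$ is the strong (Bruhat) order, $l$ the length, $\le_L$ the left weak order ($u\le_L v$ iff $l(vu^{-1})+l(u)=l(v)$) and $\le_R$ the right weak order ($u\le_R v$ iff $l(u)+l(u^{-1}v)=l(v)$). $a\lessdot b$ means $a<b$ and $l(b)=l(a)+1$. *)

theory Defs
  imports "HOL-Algebra.Generated_Groups" "HOL-Library.Extended_Nat"
begin

section \<open>Group presentations\<close>

text \<open>A word over \<open>S\<close> and its formal inverses is a list of signed letters; \<open>(s, True)\<close>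
  stands for \<open>s\<close> and \<open>(s, False)\<close> for its inverse.\<close>

type_synonym 'a signed_word = "('a \<times> bool) list"

definition eval_word :: "('a, 'b) monoid_scheme \<Rightarrow> 'a signed_word \<Rightarrow> 'a" where
  "eval_word G xs =
     foldr (\<lambda>(s, b) g. (if b then s else inv\<^bsub>G\<^esub> s) \<otimes>\<^bsub>G\<^esub> g) xs \<one>\<^bsub>G\<^esub>"

text \<open>The classes of the following congruence are the elements of the group presented by
  generators \<open>S\<close> and relators \<open>R\<close>, i.e. of the free group on \<open>S\<close> modulo the normal closure
  of \<open>R\<close>.\<close>

inductive pres_cong :: "'a set \<Rightarrow> 'a signed_word set \<Rightarrow> 'a signed_word \<Rightarrow> 'a signed_word \<Rightarrow> bool"
  for S :: "'a set" and R :: "'a signed_word set" where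
  refl: "xs \<in> lists (S \<times> UNIV) \<Longrightarrow> pres_cong S R xs xs"
| sym: "pres_cong S R xs ys \<Longrightarrow> pres_cong S R ys xs"
| trans: "pres_cong S R xs ys \<Longrightarrow> pres_cong S R ys zs \<Longrightarrow> pres_cong S R xs zs"
| cancel: "xs \<in> lists (S \<times> UNIV) \<Longrightarrow> ys \<in> lists (S \<times> UNIV) \<Longrightarrow> s \<in> S \<Longrightarrow>
    pres_cong S R (xs @ [(s, b), (s, \<not> b)] @ ys) (xs @ ys)"
| relator: "xs \<in> lists (S \<times> UNIV) \<Longrightarrow> ys \<in> lists (S \<times> UNIV) \<Longrightarrow> r \<in> R \<Longrightarrow>
    pres_cong S R (xs @ r @ ys) (xs @ ys)"

definition has_presentation ::
    "('a, 'b) monoid_scheme \<Rightarrow> 'a set \<Rightarrow> 'a signed_word set \<Rightarrow> bool" where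
  "has_presentation G S R \<longleftrightarrow>
     group G \<and> S \<subseteq> carrier G \<and> generate G S = carrier G \<and>
     (\<forall>xs \<in> lists (S \<times> UNIV). \<forall>ys \<in> lists (S \<times> UNIV).
        eval_word G xs = eval_word G ys \<longleftrightarrow> pres_cong S R xs ys)"

section \<open>Coxeter systems\<close>

definition coxeter_matrix :: "'a set \<Rightarrow> ('a \<Rightarrow> 'a \<Rightarrow> enat) \<Rightarrow> bool" where
  "coxeter_matrix S m \<longleftrightarrow>
     (\<forall>s \<in> S. \<forall>t \<in> S. m s t = m t s \<and> 1 \<le> m s t \<and> (m s t = 1 \<longleftrightarrow> s = t))"

text \<open>The relators \<open>(s t)\<^bsup>m(s,t)\<^esup>\<close>; an entry \<open>\<infinity>\<close> imposes no relation.\<close>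

definition coxeter_relators :: "'a set \<Rightarrow> ('a \<Rightarrow> 'a \<Rightarrow> enat) \<Rightarrow> 'a signed_word set" where
  "coxeter_relators S m =
     {concat (replicate k [(s, True), (t, True)]) | s t k. s \<in> S \<and> t \<in> S \<and> m s t = enat k}"

definition coxeter_system :: "('a, 'b) monoid_scheme \<Rightarrow> 'a set \<Rightarrow> bool" where
  "coxeter_system W S \<longleftrightarrow>
     (\<exists>m. coxeter_matrix S m \<and> has_presentation W S (coxeter_relators S m))"

section \<open>Length and orders\<close>

definition cox_length :: "('a, 'b) monoid_scheme \<Rightarrow> 'a set \<Rightarrow> 'a \<Rightarrow> nat" where
  "cox_length W S w =
     (LEAST n. \<exists>xs \<in> lists S. length xs = n \<and> foldr (\<otimes>\<^bsub>W\<^esub>) xs \<one>\<^bsub>W\<^esub> = w)"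

definition reflections :: "('a, 'b) monoid_scheme \<Rightarrow> 'a set \<Rightarrow> 'a set" where
  "reflections W S = {w \<otimes>\<^bsub>W\<^esub> s \<otimes>\<^bsub>W\<^esub> inv\<^bsub>W\<^esub> w | w s. w \<in> carrier W \<and> s \<in> S}"

definition bruhat_step :: "('a, 'b) monoid_scheme \<Rightarrow> 'a set \<Rightarrow> 'a \<Rightarrow> 'a \<Rightarrow> bool" where
  "bruhat_step W S u v \<longleftrightarrow>
     u \<in> carrier W \<and> (\<exists>t \<in> reflections W S. v = u \<otimes>\<^bsub>W\<^esub> t) \<and>
     cox_length W S u < cox_length W S v"

definition bruhat_le :: "('a, 'b) monoid_scheme \<Rightarrow> 'a set \<Rightarrow> 'a \<Rightarrow> 'a \<Rightarrow> bool" where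
  "bruhat_le W S = (bruhat_step W S)\<^sup>*\<^sup>*"

definition bruhat_cover :: "('a, 'b) monoid_scheme \<Rightarrow> 'a set \<Rightarrow> 'a \<Rightarrow> 'a \<Rightarrow> bool" where
  "bruhat_cover W S a b \<longleftrightarrow>
     bruhat_le W S a b \<and> a \<noteq> b \<and> cox_length W S b = cox_length W S a + 1"

definition left_weak_le :: "('a, 'b) monoid_scheme \<Rightarrow> 'a set \<Rightarrow> 'a \<Rightarrow> 'a \<Rightarrow> bool" where
  "left_weak_le W S u v \<longleftrightarrow>
     cox_length W S (v \<otimes>\<^bsub>W\<^esub> inv\<^bsub>W\<^esub> u) + cox_length W S u = cox_length W S v"

definition right_weak_le :: "('a, 'b) monoid_scheme \<Rightarrow> 'a set \<Rightarrow> 'a \<Rightarrow> 'a \<Rightarrow> bool" where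
  "right_weak_le W S u v \<longleftrightarrow>
     cox_length W S u + cox_length W S (inv\<^bsub>W\<^esub> u \<otimes>\<^bsub>W\<^esub> v) = cox_length W S v"

definition left_weak_interval :: "('a, 'b) monoid_scheme \<Rightarrow> 'a set \<Rightarrow> 'a \<Rightarrow> 'a set" where
  "left_weak_interval W S u = {w \<in> carrier W. left_weak_le W S w u}"

definition right_weak_interval :: "('a, 'b) monoid_scheme \<Rightarrow> 'a set \<Rightarrow> 'a \<Rightarrow> 'a set" where
  "right_weak_interval W S u = {w \<in> carrier W. right_weak_le W S w u}"

definition chain_property :: "('a, 'b) monoid_scheme \<Rightarrow> 'a set \<Rightarrow> 'a set \<Rightarrow> bool" where
  "chain_property W S X \<longleftrightarrow>
     (\<forall>v \<in> X. \<forall>w \<in> X. bruhat_le W S v w \<longrightarrow>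
        (\<exists>(n::nat) x. x 0 = v \<and> x n = w \<and> (\<forall>i\<le>n. x i \<in> X) \<and>
           (\<forall>i<n. bruhat_cover W S (x i) (x (Suc i)))))"

end

theory Submission
  imports Defs
begin

text \<open>The parity with which a reflection occurs among the reflections
  \<open>s\<^sub>1 \<dots> s\<^sub>i\<^sub>-\<^sub>1 s\<^sub>i s\<^sub>i\<^sub>-\<^sub>1 \<dots> s\<^sub>1\<close> of a word \<open>s\<^sub>1 \<dots> s\<^sub>k\<close> is unchanged by the Coxeter relations. This
  yields strong exchange and the lifting property of the Bruhat order.

  Given \<open>v \<le> w\<close> in \<open>[e,u]\<^sub>R\<close> with \<open>w \<noteq> e\<close>, take a left descent \<open>s\<close> of \<open>w\<close>; it is also one of \<open>u\<close>.
  Left multiplication by \<open>s\<close> carries chains of covers in \<open>[e,su]\<^sub>R\<close> to chains of covers in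
  \<open>[e,u]\<^sub>R\<close>. If \<open>sv < v\<close>, lift a chain from \<open>sv\<close> to \<open>sw\<close>. If \<open>sv > v\<close>, then \<open>v\<close> lies in
  \<open>[e,su]\<^sub>R\<close> by exchange and \<open>v \<le> sw\<close>; lift a chain from \<open>v\<close> to \<open>sw\<close> and prepend \<open>v\<close>. Inversion
  turns right intervals into left ones.\<close>

section \<open>Words, products and length in a Coxeter group\<close>

locale coxeter_group =
  fixes W :: "('a, 'b) monoid_scheme" (structure) and S :: "'a set"
  assumes coxeter: "coxeter_system W S"

sublocale coxeter_group \<subseteq> group W
  using coxeter by (auto simp: coxeter_system_def has_presentation_def)

context coxeter_group
begin

abbreviation word_prod :: "'a list \<Rightarrow> 'a" where
  "word_prod xs \<equiv> foldr (\<otimes>) xs \<one>"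

abbreviation len :: "'a \<Rightarrow> nat" where
  "len \<equiv> cox_length W S"

lemma S_carrier: "s \<in> S \<Longrightarrow> s \<in> carrier W"
  using coxeter by (auto simp: coxeter_system_def has_presentation_def)

text \<open>The diagonal entry \<open>m s s\<close> is 1, so \<open>s s\<close> is itself a
  relator.\<close>

lemma S_square: assumes "s \<in> S" shows "s \<otimes> s = \<one>"
proof -
  obtain m where m: "coxeter_matrix S m" and p: "has_presentation W S (coxeter_relators S m)"
    using coxeter by (auto simp: coxeter_system_def)
  have "m s s = enat 1" using m assms by (auto simp: coxeter_matrix_def one_enat_def)
  then have "concat (replicate 1 [(s, True), (s, True)]) \<in> coxeter_relators S m"
    unfolding coxeter_relators_def using assms by blast
  then have "[(s, True), (s, True)] \<in> coxeter_relators S m" by simp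
  from pres_cong.relator[OF _ _ this, of "[]" S "[]"]
  have "pres_cong S (coxeter_relators S m) [(s, True), (s, True)] []" by simp
  moreover have "[(s, True), (s, True)] \<in> lists (S \<times> UNIV)" using assms by auto
  ultimately have "eval_word W [(s, True), (s, True)] = eval_word W []"
    using p unfolding has_presentation_def by blast
  then show ?thesis using S_carrier[OF assms] by (simp add: eval_word_def)
qed

lemma S_inv: "s \<in> S \<Longrightarrow> inv s = s"
  by (simp add: S_carrier S_square inv_equality)

lemma inv_cancel [simp]:
  assumes "x \<in> carrier W" "y \<in> carrier W"
  shows "x \<otimes> (inv x \<otimes> y) = y" "inv x \<otimes> (x \<otimes> y) = y"
  using assms by (simp_all flip: m_assoc)

lemma S_cancel: "s \<in> S \<Longrightarrow> x \<in> carrier W \<Longrightarrow> s \<otimes> (s \<otimes> x) = x"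
  by (simp add: S_carrier S_square flip: m_assoc)

text \<open>Generators are involutions, so signs can be forgotten; this passes from the signed words
  of the presentation to plain words over \<open>S\<close>.\<close>

lemma eval_word_eq: "xs \<in> lists (S \<times> UNIV) \<Longrightarrow> eval_word W xs = word_prod (map fst xs)"
  by (induction xs) (auto simp: eval_word_def S_inv)

lemma word_prod_carrier [simp]: "xs \<in> lists S \<Longrightarrow> word_prod xs \<in> carrier W"
  by (induction xs) (auto simp: S_carrier)

lemma word_prod_append:
  "xs \<in> lists S \<Longrightarrow> ys \<in> lists S \<Longrightarrow> word_prod (xs @ ys) = word_prod xs \<otimes> word_prod ys"
  by (induction xs) (auto simp: S_carrier m_assoc)

lemma word_prod_rev: "xs \<in> lists S \<Longrightarrow> word_prod (rev xs) = inv (word_prod xs)"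
proof (induction xs)
  case (Cons s xs)
  then have "word_prod (rev xs @ [s]) = inv (word_prod xs) \<otimes> s"
    by (subst word_prod_append) (auto simp: S_carrier)
  with Cons show ?case by (simp add: S_carrier inv_mult_group S_inv)
qed simp

lemma word_exists: assumes "w \<in> carrier W" shows "\<exists>xs \<in> lists S. word_prod xs = w"
proof -
  have "w \<in> generate W S"
    using coxeter assms by (auto simp: coxeter_system_def has_presentation_def)
  then show ?thesis
  proof induction
    case one
    show ?case by (rule bexI[of _ "[]"]) auto
  next
    case (incl s)
    then show ?case by (intro bexI[of _ "[s]"]) (auto simp: S_carrier)
  next
    case (inv s)
    then show ?case by (intro bexI[of _ "[s]"]) (auto simp: S_carrier S_inv)
  next
    case (eng g h)
    then obtain xs ys where "xs \<in> lists S" "ys \<in> lists S" "word_prod xs = g" "word_prod ys = h"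
      by blast
    then show ?case by (intro bexI[of _ "xs @ ys"]) (auto simp: word_prod_append simp del: foldr_append)
  qed
qed

lemma len_le: "xs \<in> lists S \<Longrightarrow> len (word_prod xs) \<le> length xs"
  unfolding cox_length_def by (rule Least_le) auto

lemma reduced_word:
  assumes "w \<in> carrier W"
  obtains xs where "xs \<in> lists S" "word_prod xs = w" "length xs = len w"
proof -
  have "\<exists>n. \<exists>xs \<in> lists S. length xs = n \<and> word_prod xs = w"
    using word_exists[OF assms] by blast
  from LeastI_ex[OF this] show thesis using that unfolding cox_length_def by blast
qed

section \<open>Parity of crossings as an invariant of the group element\<close>

text \<open>The truth value is the parity of the number of prefixes \<open>p s\<close> of the word with
  \<open>p s p\<^sup>-\<^sup>1 = t\<close>.\<close>

primrec crossings :: "'a list \<Rightarrow> 'a \<Rightarrow> bool" where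
  "crossings [] t \<longleftrightarrow> False"
| "crossings (s # xs) t \<longleftrightarrow> (s = t) \<noteq> crossings xs (s \<otimes> t \<otimes> s)"

text \<open>A prefix ending inside \<open>ys\<close> is the product of \<open>xs\<close> times a
  prefix of \<open>ys\<close>, so its reflection is \<open>t\<close> exactly when the reflection of
  the shorter prefix is \<open>t\<close> conjugated back by that product.\<close>

lemma crossings_append:
  assumes "xs \<in> lists S" "ys \<in> lists S" "t \<in> carrier W"
  shows "crossings (xs @ ys) t \<longleftrightarrow>
    crossings xs t \<noteq> crossings ys (inv (word_prod xs) \<otimes> t \<otimes> word_prod xs)"
  using assms
proof (induction xs arbitrary: t)
  case (Cons s xs)
  then have s: "s \<in> S" "s \<in> carrier W" and xs: "xs \<in> lists S" by (auto simp: S_carrier)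
  with Cons have "crossings (xs @ ys) (s \<otimes> t \<otimes> s) \<longleftrightarrow> crossings xs (s \<otimes> t \<otimes> s) \<noteq>
      crossings ys (inv (word_prod xs) \<otimes> (s \<otimes> t \<otimes> s) \<otimes> word_prod xs)"
    by (auto simp: S_carrier)
  moreover have "inv (word_prod xs) \<otimes> (s \<otimes> t \<otimes> s) \<otimes> word_prod xs =
      inv (word_prod (s # xs)) \<otimes> t \<otimes> word_prod (s # xs)"
    using s xs word_prod_carrier[OF xs] Cons.prems(2)
    by (simp add: inv_mult_group S_inv m_assoc)
  ultimately show ?case by auto
qed simp

lemma sum_lessThan_double:
  fixes f :: "nat \<Rightarrow> nat"
  assumes "\<And>i. f (i + k) = f i"
  shows "even (\<Sum>i<2 * k. f i)"
proof -
  have "(\<Sum>i<n + k. f i) = (\<Sum>i<k. f i) + (\<Sum>i<n. f (i + k))" for n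
    by (induction n) auto
  from this[of k] assms show ?thesis by (simp add: mult_2)
qed

text \<open>The reflections attached to the prefixes of \<open>s t s t \<dots>\<close> are \<open>(s t)\<^sup>i s\<close> for \<open>i = 0, 1, \<dots>\<close>.\<close>

lemma crossings_alternating:
  assumes "s \<in> S" "t \<in> S" "r \<in> carrier W"
  shows "crossings (concat (replicate k [s, t])) r \<longleftrightarrow>
    odd (\<Sum>i<2 * k. of_bool ((s \<otimes> t) [^] i \<otimes> s = r) :: nat)"
  using assms(3)
proof (induction k arbitrary: r)
  case (Suc k)
  note [simp] = S_carrier[OF assms(1)] S_carrier[OF assms(2)]
  let ?r = "t \<otimes> (s \<otimes> r \<otimes> s) \<otimes> t"
  have 1: "t = s \<otimes> r \<otimes> s \<longleftrightarrow> (s \<otimes> t) [^] (1::nat) \<otimes> s = r"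
  proof
    assume "t = s \<otimes> r \<otimes> s"
    then have "(s \<otimes> t) \<otimes> s = s \<otimes> (s \<otimes> r \<otimes> s) \<otimes> s" by simp
    also have "\<dots> = r" using Suc.prems assms by (simp add: m_assoc S_cancel S_square)
    finally show "(s \<otimes> t) [^] (1::nat) \<otimes> s = r" by simp
  next
    assume "(s \<otimes> t) [^] (1::nat) \<otimes> s = r"
    then show "t = s \<otimes> r \<otimes> s" using assms by (auto simp: m_assoc S_cancel S_square)
  qed
  have 2: "(s \<otimes> t) [^] i \<otimes> s = ?r \<longleftrightarrow> (s \<otimes> t) [^] Suc (Suc i) \<otimes> s = r" for i :: nat
  proof -
    let ?p = "(s \<otimes> t) [^] i"
    have c: "(s \<otimes> t) \<otimes> ?p = ?p \<otimes> (s \<otimes> t)"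
      using nat_pow_Suc2[of "s \<otimes> t" i] nat_pow_Suc[of "s \<otimes> t" i] by simp
    have e: "(s \<otimes> t) \<otimes> (?p \<otimes> s) \<otimes> (t \<otimes> s) = (s \<otimes> t) [^] Suc (Suc i) \<otimes> s"
    proof -
      have "(s \<otimes> t) \<otimes> (?p \<otimes> s) \<otimes> (t \<otimes> s) = ((s \<otimes> t) \<otimes> ?p) \<otimes> (s \<otimes> t) \<otimes> s"
        by (simp add: m_assoc)
      then show ?thesis using c by (simp add: m_assoc)
    qed
    have f: "(s \<otimes> t) \<otimes> ?r \<otimes> (t \<otimes> s) = r"
      using Suc.prems assms by (simp add: m_assoc S_cancel S_square)
    have "(s \<otimes> t) \<otimes> (?p \<otimes> s) \<otimes> (t \<otimes> s) = (s \<otimes> t) \<otimes> ?r \<otimes> (t \<otimes> s) \<longleftrightarrow> ?p \<otimes> s = ?r"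
      using Suc.prems by (subst right_cancel, auto simp: m_assoc)
    then show ?thesis unfolding e f by auto
  qed
  have "crossings (concat (replicate (Suc k) [s, t])) r \<longleftrightarrow>
      (s = r) \<noteq> ((t = s \<otimes> r \<otimes> s) \<noteq> crossings (concat (replicate k [s, t])) ?r)" by simp
  also have "\<dots> \<longleftrightarrow> (s = r) \<noteq> ((t = s \<otimes> r \<otimes> s) \<noteq>
      odd (\<Sum>i<2 * k. of_bool ((s \<otimes> t) [^] i \<otimes> s = ?r) :: nat))"
    using Suc.IH[of ?r] Suc.prems by simp
  \<comment> \<open>The two leading letters give the terms \<open>i = 0\<close> and
    \<open>i = 1\<close>; conjugating \<open>r\<close> by both shifts the remaining indices by
    two.\<close>
  also have "\<dots> \<longleftrightarrow> odd (\<Sum>i<Suc (Suc (2 * k)). of_bool ((s \<otimes> t) [^] i \<otimes> s = r) :: nat)"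
    unfolding sum.lessThan_Suc_shift 1 2 by (simp del: nat_pow_Suc)
  finally show ?case by simp
qed simp

text \<open>Since the \<open>k\<close>-th power of \<open>s t\<close> is one, the sequence of prefix
  reflections has period \<open>k\<close>, and a relator of \<open>2 * k\<close> letters runs
  through two full periods. Every reflection is therefore met an even number of times.\<close>

lemma crossings_relator:
  assumes "s \<in> S" "t \<in> S" "r \<in> carrier W" "word_prod (concat (replicate k [s, t])) = \<one>"
  shows "\<not> crossings (concat (replicate k [s, t])) r"
proof -
  have st: "s \<otimes> t \<in> carrier W" using assms by (simp add: S_carrier)
  have "word_prod (concat (replicate k [s, t])) = (s \<otimes> t) [^] k"
  proof (induction k)
    case (Suc k)
    then have "word_prod (concat (replicate (Suc k) [s, t])) = (s \<otimes> t) \<otimes> (s \<otimes> t) [^] k"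
      using assms by (simp add: S_carrier m_assoc del: nat_pow_Suc)
    then show ?case using nat_pow_Suc2[OF st, of k] by simp
  qed simp
  with assms have "(s \<otimes> t) [^] k = \<one>" by simp
  then have "(s \<otimes> t) [^] (i + k) = (s \<otimes> t) [^] i" for i
    using st by (simp flip: nat_pow_mult)
  then show ?thesis using crossings_alternating[OF assms(1-3), of k]
      sum_lessThan_double[of "\<lambda>i. of_bool ((s \<otimes> t) [^] i \<otimes> s = r)" k] by simp
qed

lemma crossings_insert:
  assumes "xs \<in> lists S" "ys \<in> lists S" "zs \<in> lists S" "word_prod ys = \<one>"
    and "\<And>r. r \<in> carrier W \<Longrightarrow> \<not> crossings ys r" "t \<in> carrier W"
  shows "crossings (xs @ ys @ zs) t \<longleftrightarrow> crossings (xs @ zs) t"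
  using assms by (simp add: crossings_append del: foldr_append)

text \<open>By the presentation, words with equal products are linked by cancellations and relators,
  and each of these inserts or removes a subword of product one without odd crossings. The parity is
  thus a function of the group element.\<close>

lemma crossings_eq:
  assumes "xs \<in> lists S" "ys \<in> lists S" "word_prod xs = word_prod ys" "t \<in> carrier W"
  shows "crossings xs t \<longleftrightarrow> crossings ys t"
proof -
  obtain m where p: "has_presentation W S (coxeter_relators S m)"
    using coxeter by (auto simp: coxeter_system_def)
  have fst: "map fst zs \<in> lists S" if "zs \<in> lists (S \<times> UNIV)" for zs :: "('a \<times> bool) list"
    using that by (induction zs) auto
  have inv: "crossings (map fst as) t \<longleftrightarrow> crossings (map fst bs) t"
    if "pres_cong S (coxeter_relators S m) as bs" for as bs
    using that
  proof induction
    case (cancel as bs s b)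
    \<comment> \<open>Both prefixes of \<open>s s\<close> give the reflection \<open>s\<close>, so
      it is counted twice and nothing else is counted.\<close>
    have "\<not> crossings [s, s] r" if "r \<in> carrier W" for r
    proof -
      have "s = s \<otimes> r \<otimes> s \<longleftrightarrow> s = r"
        using S_inv[OF cancel(3)] S_square[OF cancel(3)] S_carrier[OF cancel(3)] that
        by (metis inv_equality m_assoc m_closed r_one l_one)
      then show ?thesis by simp
    qed
    with cancel have "crossings (map fst as @ [s, s] @ map fst bs) t \<longleftrightarrow>
        crossings (map fst as @ map fst bs) t"
      by (intro crossings_insert fst assms) (auto simp: S_carrier S_square)
    then show ?case by simp
  next
    case (relator as bs q)
    from relator(3) obtain s t' k where q: "q = concat (replicate k [(s, True), (t', True)])"
      and st: "s \<in> S" "t' \<in> S" unfolding coxeter_relators_def by blast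
    have qm: "map fst q = concat (replicate k [s, t'])"
      unfolding q by (simp add: map_concat)
    have ql: "q \<in> lists (S \<times> UNIV)" unfolding q using st by (auto simp: in_lists_conv_set)
    \<comment> \<open>The relator rule in the empty context shows that \<open>q\<close> evaluates to
      one.\<close>
    have "pres_cong S (coxeter_relators S m) ([] @ q @ []) ([] @ [])"
      using relator(3) by (intro pres_cong.relator) auto
    then have "eval_word W q = eval_word W []"
      using p ql unfolding has_presentation_def by fastforce
    then have "word_prod (map fst q) = \<one>" using ql by (simp add: eval_word_eq)
    with st have "crossings (map fst as @ map fst q @ map fst bs) t \<longleftrightarrow>
        crossings (map fst as @ map fst bs) t"
      by (intro crossings_insert fst ql relator(1,2) assms) (auto simp: qm crossings_relator)
    then show ?case by simp
  qed auto
  let ?f = "map (\<lambda>s. (s, True))"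
  have l: "?f zs \<in> lists (S \<times> UNIV)" "map fst (?f zs) = zs" if "zs \<in> lists S" for zs
    using that by (auto simp: in_lists_conv_set comp_def)
  have "eval_word W (?f xs) = eval_word W (?f ys)"
    using assms l by (simp only: eval_word_eq)
  then have "pres_cong S (coxeter_relators S m) (?f xs) (?f ys)"
    using p l assms unfolding has_presentation_def by blast
  from inv[OF this] l assms show ?thesis by simp
qed

text \<open>An odd count means that some prefix \<open>p s\<close> satisfies
  \<open>t = p s p\<^sup>-\<^sup>1\<close>, and multiplying by this \<open>t\<close> from the left
  removes that \<open>s\<close>. The induction peels off the first letter and conjugates
  \<open>t\<close> by it.\<close>

lemma crossings_deletion:
  assumes "xs \<in> lists S" "t \<in> carrier W" "crossings xs t"
  shows "\<exists>as s bs. xs = as @ s # bs \<and> t \<otimes> word_prod xs = word_prod (as @ bs)"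
  using assms
proof (induction xs arbitrary: t)
  case (Cons s xs)
  then have s: "s \<in> S" "s \<in> carrier W" and xs: "xs \<in> lists S" by (auto simp: S_carrier)
  show ?case
  proof (cases "s = t")
    case True
    then have "t \<otimes> word_prod (s # xs) = word_prod ([] @ xs)" using s xs by (simp add: S_cancel)
    then show ?thesis by blast
  next
    case False
    with Cons s xs obtain as a bs where 1: "xs = as @ a # bs"
      and 2: "s \<otimes> t \<otimes> s \<otimes> word_prod xs = word_prod (as @ bs)"
      by (metis crossings.simps(2) m_closed)
    have "t \<otimes> word_prod (s # xs) = s \<otimes> (s \<otimes> t \<otimes> s \<otimes> word_prod xs)"
      using s xs Cons.prems by (simp add: m_assoc S_cancel)
    then have "t \<otimes> word_prod (s # xs) = word_prod ((s # as) @ bs)" using 2 by simp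
    moreover have "s # xs = (s # as) @ a # bs" using 1 by simp
    ultimately show ?thesis by blast
  qed
qed simp

section \<open>Reflections and strong exchange\<close>

lemma reflection_carrier: "t \<in> reflections W S \<Longrightarrow> t \<in> carrier W"
  by (auto simp: reflections_def S_carrier)

lemma S_reflection: "s \<in> S \<Longrightarrow> s \<in> reflections W S"
  unfolding reflections_def mem_Collect_eq
  by (intro exI[of _ \<one>] exI[of _ s]) (simp add: S_carrier)

lemma reflection_conj:
  assumes "t \<in> reflections W S" "g \<in> carrier W"
  shows "g \<otimes> t \<otimes> inv g \<in> reflections W S"
proof -
  obtain h s where h: "h \<in> carrier W" "s \<in> S" "t = h \<otimes> s \<otimes> inv h"
    using assms by (auto simp: reflections_def)
  then have "g \<otimes> t \<otimes> inv g = (g \<otimes> h) \<otimes> s \<otimes> inv (g \<otimes> h)"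
    using assms by (simp add: S_carrier m_assoc inv_mult_group)
  then show ?thesis unfolding reflections_def using h assms m_closed by blast
qed

lemma reflection_square: assumes "t \<in> reflections W S" shows "t \<otimes> t = \<one>"
proof -
  obtain h s where h: "h \<in> carrier W" "s \<in> S" "t = h \<otimes> s \<otimes> inv h"
    using assms by (auto simp: reflections_def)
  have "t \<otimes> t = h \<otimes> (s \<otimes> ((inv h \<otimes> h) \<otimes> (s \<otimes> inv h)))"
    using h by (simp add: m_assoc S_carrier)
  then show ?thesis using h by (simp add: S_carrier S_cancel)
qed

text \<open>Parity depends only on the product, so it may be computed on a palindrome
  \<open>xs s (rev xs)\<close> for \<open>t\<close>: the two outer halves contribute equally and the
  middle letter contributes once.\<close>

lemma reflection_crossings:
  assumes t: "t \<in> reflections W S" and zs: "zs \<in> lists S" "word_prod zs = t"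
  shows "crossings zs t"
proof -
  obtain h s where h: "h \<in> carrier W" "s \<in> S" "t = h \<otimes> s \<otimes> inv h"
    using t by (auto simp: reflections_def)
  obtain xs where xs: "xs \<in> lists S" "word_prod xs = h" using word_exists[OF h(1)] by blast
  have rxs: "rev xs \<in> lists S" using xs by auto
  have s: "s \<in> carrier W" "[s] \<in> lists S" using h by (auto simp: S_carrier)
  have tc: "t \<in> carrier W" by (rule reflection_carrier[OF t])
  have "inv h \<otimes> t \<otimes> h = (inv h \<otimes> h) \<otimes> s \<otimes> (inv h \<otimes> h)"
    unfolding h(3) using h(1) s(1) by (simp add: m_assoc)
  then have c: "inv h \<otimes> t \<otimes> h = s" using h s by simp
  \<comment> \<open>This word has product one, like the empty word, so its two halves cancel in
    parity.\<close>
  have "\<not> crossings (xs @ rev xs) t"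
    using crossings_eq[of "xs @ rev xs" "[]" t] xs rxs tc h(1)
    by (simp add: word_prod_append word_prod_rev del: foldr_append)
  then have 1: "crossings xs t \<longleftrightarrow> crossings (rev xs) s"
    using crossings_append[OF xs(1) rxs tc] xs c by simp
  have "crossings (xs @ [s] @ rev xs) t \<longleftrightarrow> crossings xs t \<noteq> crossings ([s] @ rev xs) s"
    using crossings_append[OF xs(1) _ tc, of "[s] @ rev xs"] xs rxs s c by simp
  also have "crossings ([s] @ rev xs) s \<longleftrightarrow> \<not> crossings (rev xs) s"
    using h s by (simp add: S_square)
  finally have "crossings (xs @ [s] @ rev xs) t" using 1 by simp
  moreover have "word_prod (xs @ [s] @ rev xs) = t"
    using xs rxs s h by (subst word_prod_append) (auto simp: word_prod_rev m_assoc)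
  ultimately show ?thesis
    using crossings_eq[of "xs @ [s] @ rev xs" zs t] xs rxs s zs tc by auto
qed

text \<open>Parity can be read off a reduced word of \<open>w\<close>, from which \<open>t\<close>
  then deletes a letter.\<close>

lemma crossings_imp_len_less:
  assumes "w \<in> carrier W" "t \<in> carrier W" "xs \<in> lists S" "word_prod xs = w" "crossings xs t"
  shows "len (t \<otimes> w) < len w"
proof -
  obtain ys where ys: "ys \<in> lists S" "word_prod ys = w" "length ys = len w"
    using reduced_word[OF assms(1)] .
  have "crossings ys t" using crossings_eq assms ys by metis
  then obtain as s bs where d: "ys = as @ s # bs" "t \<otimes> w = word_prod (as @ bs)"
    using crossings_deletion[of ys t] ys assms by metis
  then have "len (t \<otimes> w) \<le> length (as @ bs)" using ys len_le[of "as @ bs"] by auto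
  then show ?thesis using ys d by simp
qed

text \<open>Prefixing a word for \<open>t\<close> flips the parity at \<open>t\<close>, because
  \<open>t\<close> crosses itself and is fixed under conjugation by itself. The previous case then
  applies to \<open>t \<otimes> w\<close>, and \<open>t\<close> brings it back to
  \<open>w\<close>.\<close>

lemma not_crossings_imp_len_less:
  assumes "t \<in> reflections W S" "w \<in> carrier W" "xs \<in> lists S" "word_prod xs = w"
    "\<not> crossings xs t"
  shows "len w < len (t \<otimes> w)"
proof -
  have tc: "t \<in> carrier W" by (rule reflection_carrier[OF assms(1)])
  obtain zs where zs: "zs \<in> lists S" "word_prod zs = t" using word_exists[OF tc] by blast
  have "inv t \<otimes> t \<otimes> t = t" using tc by simp
  then have "crossings (zs @ xs) t"
    using crossings_append[OF zs(1) assms(3) tc] reflection_crossings[OF assms(1) zs] assms(5) zs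
    by simp
  moreover have "word_prod (zs @ xs) = t \<otimes> w" using word_prod_append zs assms by blast
  ultimately have "len (t \<otimes> (t \<otimes> w)) < len (t \<otimes> w)"
    using crossings_imp_len_less[of "t \<otimes> w" t "zs @ xs"] tc assms zs by simp
  moreover have "t \<otimes> (t \<otimes> w) = w"
    using reflection_square[OF assms(1)] tc assms(2) by (simp flip: m_assoc)
  ultimately show ?thesis by simp
qed

lemma len_reflection_neq:
  assumes "t \<in> reflections W S" "w \<in> carrier W" shows "len (t \<otimes> w) \<noteq> len w"
proof -
  obtain xs where "xs \<in> lists S" "word_prod xs = w" using word_exists[OF assms(2)] by blast
  from crossings_imp_len_less[OF assms(2) reflection_carrier[OF assms(1)] this]
    not_crossings_imp_len_less[OF assms this]
  show ?thesis by (cases "crossings xs t") auto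
qed

lemma strong_exchange:
  assumes "t \<in> reflections W S" "xs \<in> lists S" "len (t \<otimes> word_prod xs) < len (word_prod xs)"
  obtains as s bs where "xs = as @ s # bs" "t \<otimes> word_prod xs = word_prod (as @ bs)"
proof -
  have "crossings xs t"
    using not_crossings_imp_len_less[OF assms(1) word_prod_carrier[OF assms(2)] assms(2) HOL.refl]
      assms(3)
    by (meson less_asym)
  then show thesis using crossings_deletion[OF assms(2) reflection_carrier[OF assms(1)]] that by blast
qed

section \<open>Length under products, inversion and simple reflections\<close>

lemma len_mult_le: assumes "v \<in> carrier W" "w \<in> carrier W" shows "len (v \<otimes> w) \<le> len v + len w"
proof -
  obtain xs where xs: "xs \<in> lists S" "word_prod xs = v" "length xs = len v"
    using reduced_word[OF assms(1)] .
  obtain ys where ys: "ys \<in> lists S" "word_prod ys = w" "length ys = len w"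
    using reduced_word[OF assms(2)] .
  show ?thesis using len_le[of "xs @ ys"] xs ys word_prod_append[of xs ys] by simp
qed

lemma len_inv [simp]: assumes "w \<in> carrier W" shows "len (inv w) = len w"
proof -
  have le: "len (inv v) \<le> len v" if v: "v \<in> carrier W" for v
  proof -
    obtain xs where xs: "xs \<in> lists S" "word_prod xs = v" "length xs = len v"
      using reduced_word[OF v] .
    then have "rev xs \<in> lists S" by auto
    from len_le[OF this] show ?thesis using xs by (simp only: word_prod_rev length_rev)
  qed
  show ?thesis using le[OF assms] le[of "inv w"] assms by simp
qed

text \<open>Subadditivity bounds the change by one, and a reflection always changes the
  length.\<close>

lemma len_S_mult:
  assumes "s \<in> S" "w \<in> carrier W"
  shows "len (s \<otimes> w) = len w + 1 \<or> len w = len (s \<otimes> w) + 1"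
proof -
  have "len s \<le> 1" using len_le[of "[s]"] assms by (simp add: S_carrier)
  moreover have "len (s \<otimes> w) \<le> len s + len w" "len (s \<otimes> (s \<otimes> w)) \<le> len s + len (s \<otimes> w)"
    using len_mult_le assms S_carrier by auto
  moreover have "len (s \<otimes> w) \<noteq> len w" using len_reflection_neq S_reflection assms by blast
  ultimately show ?thesis unfolding S_cancel[OF assms] by arith
qed

lemma left_descent_exists:
  assumes "w \<in> carrier W" "len w \<noteq> 0"
  obtains s where "s \<in> S" "len w = len (s \<otimes> w) + 1"
proof -
  obtain xs where xs: "xs \<in> lists S" "word_prod xs = w" "length xs = len w"
    using reduced_word[OF assms(1)] .
  then obtain s ys where [simp]: "xs = s # ys" using assms by (cases xs) auto
  have "s \<in> S" "ys \<in> lists S" using xs by auto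
  moreover from this xs have "s \<otimes> w = word_prod ys"
    using S_cancel[OF _ word_prod_carrier] by auto
  ultimately show thesis using that[of s] len_S_mult[of s w] len_le[of ys] xs assms by fastforce
qed

section \<open>Bruhat order and the lifting property\<close>

lemma bruhat_stepE:
  assumes "bruhat_step W S x y"
  obtains t where "t \<in> reflections W S" "x \<in> carrier W" "y \<in> carrier W" "y = x \<otimes> t"
    "len x < len y"
  using assms unfolding bruhat_step_def by (auto simp: reflection_carrier)

text \<open>Conjugation by \<open>x\<close> moves the reflection from one side of \<open>x\<close>
  to the other.\<close>

lemma bruhat_step_iff_left:
  "bruhat_step W S x y \<longleftrightarrow>
    x \<in> carrier W \<and> (\<exists>t \<in> reflections W S. y = t \<otimes> x) \<and> len x < len y"
proof -
  have "x \<otimes> t = (x \<otimes> t \<otimes> inv x) \<otimes> x" "t \<otimes> x = x \<otimes> (inv x \<otimes> t \<otimes> inv (inv x))"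
    if "x \<in> carrier W" "t \<in> reflections W S" for t
    using that by (simp_all add: m_assoc reflection_carrier)
  then have "(\<exists>t \<in> reflections W S. y = x \<otimes> t) \<longleftrightarrow> (\<exists>t \<in> reflections W S. y = t \<otimes> x)"
    if "x \<in> carrier W"
    using reflection_conj that inv_closed[OF that] by metis
  then show ?thesis unfolding bruhat_step_def by blast
qed

lemma bruhat_le_trans: "bruhat_le W S x y \<Longrightarrow> bruhat_le W S y z \<Longrightarrow> bruhat_le W S x z"
  unfolding bruhat_le_def by simp

lemma bruhat_step_le: "bruhat_step W S x y \<Longrightarrow> bruhat_le W S x y"
  unfolding bruhat_le_def by simp

lemma bruhat_le_refl: "bruhat_le W S x x"
  unfolding bruhat_le_def by simp

lemma bruhat_le_len: "bruhat_le W S x y \<Longrightarrow> x = y \<or> len x < len y"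
  unfolding bruhat_le_def by (induction rule: rtranclp_induct) (auto simp: bruhat_step_def)

lemma bruhat_step_S:
  assumes "s \<in> S" "x \<in> carrier W" "len x < len (s \<otimes> x)"
  shows "bruhat_step W S x (s \<otimes> x)"
  unfolding bruhat_step_iff_left using assms S_reflection by blast

text \<open>Multiplication by \<open>s\<close> can reverse a step only by swapping its ends.
  Otherwise exchange in a reduced word of \<open>y\<close> starting with \<open>s\<close> would make
  \<open>s \<otimes> x\<close> too short.\<close>

lemma bruhat_step_S_mult:
  assumes "s \<in> S" "bruhat_step W S x y" "s \<otimes> x \<noteq> y"
  shows "bruhat_step W S (s \<otimes> x) (s \<otimes> y)"
proof -
  note s = assms(1) S_carrier[OF assms(1)]
  obtain t where t: "t \<in> reflections W S" "y = x \<otimes> t" and len: "len x < len y"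
    and x: "x \<in> carrier W" and y: "y \<in> carrier W"
    using assms(2) by (auto elim: bruhat_stepE)
  obtain t' where t': "t' \<in> reflections W S" "y = t' \<otimes> x"
    using assms(2) unfolding bruhat_step_iff_left by blast
  have sy: "s \<otimes> y = (s \<otimes> x) \<otimes> t" using t x s by (simp add: m_assoc reflection_carrier)
  have "len (s \<otimes> x) < len (s \<otimes> y)"
  proof (rule ccontr)
    assume nless: "\<not> ?thesis"
    have "s \<otimes> y = (s \<otimes> t' \<otimes> inv s) \<otimes> (s \<otimes> x)"
      using t' x s by (simp add: m_assoc reflection_carrier S_inv S_cancel)
    then have "len (s \<otimes> y) \<noteq> len (s \<otimes> x)"
      using len_reflection_neq[OF reflection_conj[OF t'(1) s(2)]] x s by simp
    with nless have "len (s \<otimes> y) < len (s \<otimes> x)" by simp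
    \<comment> \<open>Multiplication by \<open>s\<close> changes lengths by one, so \<open>len (s
      \<otimes> y) < len (s \<otimes> x) \<le> len x + 1 \<le> len y \<le> len (s \<otimes> y) +
      1\<close> leaves no slack.\<close>
    then have l: "len y = len x + 1" "len (s \<otimes> x) = len x + 1" "len y = len (s \<otimes> y) + 1"
      using len_S_mult[OF s(1) x] len_S_mult[OF s(1) y] len by linarith+
    obtain ys where ys: "ys \<in> lists S" "word_prod ys = s \<otimes> y" "length ys = len (s \<otimes> y)"
      using reduced_word s y by (metis m_closed)
    have y': "word_prod (s # ys) = y" using ys s y by (simp add: S_cancel)
    have x': "t' \<otimes> y = x"
      using reflection_square[OF t'(1)] reflection_carrier[OF t'(1)] t' x by (simp flip: m_assoc)
    obtain as a bs where d: "s # ys = as @ a # bs" "x = word_prod (as @ bs)"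
      using strong_exchange[OF t'(1), of "s # ys"] ys y' x' s len by (metis Cons_in_lists_iff)
    show False
    proof (cases as)
      \<comment> \<open>Deleting the leading \<open>s\<close> would give
        \<open>s \<otimes> x = y\<close>, the excluded case.\<close>
      case Nil
      with d ys have "x = s \<otimes> y" by auto
      with assms(3) s y show False by (simp add: S_cancel)
    next
      case (Cons s' cs)
      with d have [simp]: "s' = s" and e: "ys = cs @ a # bs" by auto
      then have cb: "cs @ bs \<in> lists S" using ys by auto
      have "x = s \<otimes> word_prod (cs @ bs)" using d Cons by simp
      then have "s \<otimes> x = word_prod (cs @ bs)" using cb S_cancel[OF s(1)] word_prod_carrier by metis
      then have "len (s \<otimes> x) \<le> length (cs @ bs)" using len_le[OF cb] by simp
      then show False using e ys l by simp
    qed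
  qed
  then show ?thesis unfolding bruhat_step_def using sy t x s by auto
qed

text \<open>The conditional picks the shorter of \<open>v\<close> and \<open>s \<otimes> v\<close>.
  It lies below both, so it suffices to put either one below \<open>s \<otimes> w\<close>; the
  induction prepends one Bruhat step at the bottom.\<close>

lemma lifting:
  assumes "bruhat_le W S v w" "s \<in> S" "w \<in> carrier W" "len (s \<otimes> w) < len w"
  shows "v \<in> carrier W \<and> bruhat_le W S (if len (s \<otimes> v) < len v then s \<otimes> v else v) (s \<otimes> w)"
  using assms(1) unfolding bruhat_le_def
proof (induction rule: converse_rtranclp_induct)
  case base
  then show ?case using assms by simp
next
  case (step v x)
  note le = bruhat_le_def[symmetric]
  have c: "v \<in> carrier W" "x \<in> carrier W" using step by (auto simp: bruhat_step_def)
  let ?m = "if len (s \<otimes> v) < len v then s \<otimes> v else v"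
  have ml: "bruhat_le W S ?m v" "bruhat_le W S ?m (s \<otimes> v)"
  proof -
    have "bruhat_step W S (s \<otimes> v) v" if "len (s \<otimes> v) < len v"
      using bruhat_step_S[of s "s \<otimes> v"] that c assms by (simp add: S_cancel S_carrier)
    moreover have "bruhat_step W S v (s \<otimes> v)" if "\<not> len (s \<otimes> v) < len v"
      using bruhat_step_S[of s v] len_S_mult[of s v] that c assms by auto
    ultimately show "bruhat_le W S ?m v" "bruhat_le W S ?m (s \<otimes> v)"
      by (auto simp: bruhat_le_refl bruhat_step_le)
  qed
  have "bruhat_le W S v (s \<otimes> w) \<or> bruhat_le W S (s \<otimes> v) (s \<otimes> w)"
  proof (cases "len (s \<otimes> x) < len x")
    case True
    then have IH: "bruhat_le W S (s \<otimes> x) (s \<otimes> w)" using step.IH by (simp add: le)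
    show ?thesis
    proof (cases "s \<otimes> v = x")
      case True
      then have "s \<otimes> x = v" using c assms S_cancel by auto
      with IH show ?thesis by simp
    next
      case False
      from bruhat_step_S_mult[OF assms(2) step.hyps(1) this] IH show ?thesis
        using bruhat_step_le bruhat_le_trans by blast
    qed
  next
    case False
    then have "bruhat_le W S x (s \<otimes> w)" using step.IH by (simp add: le)
    then show ?thesis using step.hyps(1) bruhat_step_le bruhat_le_trans by blast
  qed
  then show ?case using ml bruhat_le_trans c unfolding le by blast
qed

section \<open>Covers and chains\<close>

text \<open>The first step of a Bruhat chain already uses up the length difference of one.\<close>

lemma bruhat_cover_step: "bruhat_cover W S a b \<Longrightarrow> bruhat_step W S a b"
proof -
  assume c: "bruhat_cover W S a b"
  then have "(bruhat_step W S)\<^sup>*\<^sup>* a b" "a \<noteq> b" "len b = len a + 1"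
    by (auto simp: bruhat_cover_def bruhat_le_def)
  then obtain x where x: "bruhat_step W S a x" "(bruhat_step W S)\<^sup>*\<^sup>* x b"
    by (metis converse_rtranclpE)
  moreover from this have "x = b \<or> len x < len b"
    using bruhat_le_len by (simp add: bruhat_le_def)
  moreover have "len a < len x" using x by (simp add: bruhat_step_def)
  ultimately show ?thesis using \<open>len b = len a + 1\<close> by auto
qed

lemma bruhat_coverI:
  "bruhat_step W S a b \<Longrightarrow> len b = len a + 1 \<Longrightarrow> bruhat_cover W S a b"
  by (auto simp: bruhat_cover_def bruhat_step_le)

text \<open>As \<open>s\<close> lengthens \<open>y\<close>, the swap
  \<open>s \<otimes> x = y\<close> is impossible, so the step is preserved.\<close>

lemma bruhat_cover_S_mult:
  assumes "s \<in> S" "bruhat_cover W S x y" "len (s \<otimes> x) = len x + 1" "len (s \<otimes> y) = len y + 1"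
  shows "bruhat_cover W S (s \<otimes> x) (s \<otimes> y)"
proof -
  have st: "bruhat_step W S x y" by (rule bruhat_cover_step[OF assms(2)])
  have l: "len y = len x + 1" using assms(2) by (simp add: bruhat_cover_def)
  have "x \<in> carrier W" using st by (simp add: bruhat_step_def)
  then have "s \<otimes> x \<noteq> y" using assms l S_cancel by fastforce
  from bruhat_step_S_mult[OF assms(1) st this] show ?thesis
    using assms l by (intro bruhat_coverI) auto
qed

text \<open>Isolates the existential part of \<open>chain_property\<close>, so that chains can be
  mapped and extended.\<close>

definition chain_in :: "'a set \<Rightarrow> 'a \<Rightarrow> 'a \<Rightarrow> bool" where
  "chain_in X v w \<longleftrightarrow> (\<exists>(n::nat) x. x 0 = v \<and> x n = w \<and> (\<forall>i\<le>n. x i \<in> X) \<and>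
     (\<forall>i<n. bruhat_cover W S (x i) (x (Suc i))))"

lemma chain_property_iff:
  "chain_property W S X \<longleftrightarrow> (\<forall>v \<in> X. \<forall>w \<in> X. bruhat_le W S v w \<longrightarrow> chain_in X v w)"
  unfolding chain_property_def chain_in_def ..

lemma chain_in_refl: "w \<in> X \<Longrightarrow> chain_in X w w"
  unfolding chain_in_def by (intro exI[of _ 0] exI[of _ "\<lambda>_. w"]) auto

lemma chain_in_image:
  assumes "chain_in X v w"
    and "\<And>x. x \<in> X \<Longrightarrow> f x \<in> Y"
    and "\<And>x y. x \<in> X \<Longrightarrow> y \<in> X \<Longrightarrow> bruhat_cover W S x y \<Longrightarrow> bruhat_cover W S (f x) (f y)"
  shows "chain_in Y (f v) (f w)"
proof -
  obtain n x where "x 0 = v" "x n = w" "\<forall>i\<le>n. x i \<in> X"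
    "\<forall>i<n. bruhat_cover W S (x i) (x (Suc i))" using assms(1) unfolding chain_in_def by blast
  then show ?thesis using assms(2,3) unfolding chain_in_def
    by (intro exI[of _ n] exI[of _ "f \<circ> x"]) auto
qed

lemma chain_in_Cons:
  assumes "chain_in X v w" "u \<in> X" "bruhat_cover W S u v"
  shows "chain_in X u w"
proof -
  obtain n x where "x 0 = v" "x n = w" "\<forall>i\<le>n. x i \<in> X"
    "\<forall>i<n. bruhat_cover W S (x i) (x (Suc i))" using assms(1) unfolding chain_in_def by blast
  then show ?thesis using assms(2,3) unfolding chain_in_def
    by (intro exI[of _ "Suc n"] exI[of _ "case_nat u x"]) (auto split: nat.split)
qed

section \<open>Right weak intervals under a left descent\<close>

text \<open>The quotient \<open>inv x \<otimes> (s \<otimes> u)\<close> is unchanged when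
  \<open>s\<close> is moved onto \<open>x\<close>. Were \<open>s \<otimes> x\<close> shorter than
  \<open>x\<close>, subadditivity would make \<open>u\<close> shorter than
  \<open>s \<otimes> u\<close>.\<close>

lemma right_weak_interval_S_mult:
  assumes "s \<in> S" "u \<in> carrier W" "len u = len (s \<otimes> u) + 1"
    and "x \<in> right_weak_interval W S (s \<otimes> u)"
  shows "s \<otimes> x \<in> right_weak_interval W S u \<and> len (s \<otimes> x) = len x + 1"
proof -
  note s = assms(1) S_carrier[OF assms(1)]
  have x: "x \<in> carrier W" "len x + len (inv x \<otimes> (s \<otimes> u)) = len (s \<otimes> u)"
    using assms by (auto simp: right_weak_interval_def right_weak_le_def)
  have i: "inv (s \<otimes> x) \<otimes> u = inv x \<otimes> (s \<otimes> u)"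
    using s x assms by (simp add: inv_mult_group S_inv m_assoc)
  have "(s \<otimes> x) \<otimes> (inv (s \<otimes> x) \<otimes> u) = u" using s x assms by (simp flip: m_assoc)
  moreover have "len ((s \<otimes> x) \<otimes> (inv (s \<otimes> x) \<otimes> u)) \<le> len (s \<otimes> x) + len (inv (s \<otimes> x) \<otimes> u)"
    using s x assms by (intro len_mult_le) auto
  ultimately have "len (s \<otimes> x) = len x + 1"
    using len_S_mult[OF s(1) x(1)] x(2) assms(3) unfolding i by simp
  then show ?thesis using x s assms i by (simp add: right_weak_interval_def right_weak_le_def)
qed

text \<open>A left descent of \<open>x\<close> is inherited by \<open>u\<close>: a reduced word of
  \<open>x\<close> starting with \<open>s\<close> extends to one of \<open>u\<close>. The quotient
  is again unchanged.\<close>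

lemma right_weak_interval_descent:
  assumes "s \<in> S" "u \<in> carrier W" "x \<in> right_weak_interval W S u" "len x = len (s \<otimes> x) + 1"
  shows "len u = len (s \<otimes> u) + 1 \<and> s \<otimes> x \<in> right_weak_interval W S (s \<otimes> u)"
proof -
  note s = assms(1) S_carrier[OF assms(1)]
  have x: "x \<in> carrier W" "len x + len (inv x \<otimes> u) = len u"
    using assms by (auto simp: right_weak_interval_def right_weak_le_def)
  have i: "inv (s \<otimes> x) \<otimes> (s \<otimes> u) = inv x \<otimes> u"
    using s x assms by (simp add: inv_mult_group S_inv m_assoc S_cancel)
  have "(s \<otimes> x) \<otimes> (inv x \<otimes> u) = s \<otimes> u"
    using s x assms by (simp add: m_assoc)
  moreover have "len ((s \<otimes> x) \<otimes> (inv x \<otimes> u)) \<le> len (s \<otimes> x) + len (inv x \<otimes> u)"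
    using s x assms by (intro len_mult_le) auto
  ultimately have "len u = len (s \<otimes> u) + 1"
    using len_S_mult[OF s(1) assms(2)] x(2) assms(4) by simp
  then show ?thesis using x s assms i by (simp add: right_weak_interval_def right_weak_le_def)
qed

text \<open>In a reduced word of \<open>u\<close> beginning with one of \<open>x\<close>, the letter deleted by exchange with
  \<open>s\<close> lies outside \<open>x\<close>.\<close>

lemma right_weak_interval_non_descent:
  assumes "s \<in> S" "u \<in> carrier W" "len u = len (s \<otimes> u) + 1"
    and "x \<in> right_weak_interval W S u" "len (s \<otimes> x) = len x + 1"
  shows "x \<in> right_weak_interval W S (s \<otimes> u)"
proof -
  note s = assms(1) S_carrier[OF assms(1)]
  have x: "x \<in> carrier W" "len x + len (inv x \<otimes> u) = len u"
    using assms by (auto simp: right_weak_interval_def right_weak_le_def)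
  obtain xs where xs: "xs \<in> lists S" "word_prod xs = x" "length xs = len x"
    using reduced_word[OF x(1)] .
  obtain ys where ys: "ys \<in> lists S" "word_prod ys = inv x \<otimes> u" "length ys = len (inv x \<otimes> u)"
    using reduced_word[of "inv x \<otimes> u"] x assms by auto
  have not_cross: "\<not> crossings xs s"
    using crossings_imp_len_less[OF x(1) s(2) xs(1,2)] assms(5) by auto
  have xy: "word_prod (xs @ ys) = u"
    using xs ys x assms by (simp add: word_prod_append del: foldr_append)
  have "crossings (xs @ ys) s"
    using not_crossings_imp_len_less[OF S_reflection[OF s(1)] assms(2) _ xy] xs ys assms(3) by auto
  then have "crossings ys (inv x \<otimes> s \<otimes> x)"
    using crossings_append[OF xs(1) ys(1) s(2)] not_cross xs by simp
  then have "len ((inv x \<otimes> s \<otimes> x) \<otimes> (inv x \<otimes> u)) < len (inv x \<otimes> u)"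
    using crossings_imp_len_less[OF _ _ ys(1,2)] x s assms by simp
  moreover have "(inv x \<otimes> s \<otimes> x) \<otimes> (inv x \<otimes> u) = inv x \<otimes> (s \<otimes> u)"
    using x s assms by (simp add: m_assoc)
  moreover have "x \<otimes> (inv x \<otimes> (s \<otimes> u)) = s \<otimes> u"
    using x s assms by (simp flip: m_assoc)
  then have "len (s \<otimes> u) \<le> len x + len (inv x \<otimes> (s \<otimes> u))"
    using len_mult_le[of x "inv x \<otimes> (s \<otimes> u)"] x s assms by simp
  \<comment> \<open>Exchange bounds the length of the new quotient from above by
    \<open>len (s \<otimes> u) - len x\<close>, and subadditivity bounds it from below by the same
    number.\<close>
  ultimately show ?thesis
    using x assms by (simp add: right_weak_interval_def right_weak_le_def)
qed

section \<open>Chain property of right weak intervals\<close>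

lemma chain_in_right_weak_interval:
  assumes "u \<in> carrier W" "v \<in> right_weak_interval W S u" "w \<in> right_weak_interval W S u"
    and "bruhat_le W S v w"
  shows "chain_in (right_weak_interval W S u) v w"
  using assms
\<comment> \<open>\<open>u\<close> is generalised because the induction hypothesis is used in the
  interval below \<open>s \<otimes> u\<close>.\<close>
proof (induction "len w" arbitrary: u v w rule: less_induct)
  case less
  have c: "v \<in> carrier W" "w \<in> carrier W"
    using less.prems by (auto simp: right_weak_interval_def)
  show ?case
  proof (cases "len w = 0")
    case True
    then have "v = w" using bruhat_le_len[OF less.prems(4)] by simp
    then show ?thesis using less.prems(3) chain_in_refl by simp
  next
    case False
    then obtain s where s: "s \<in> S" and sw: "len w = len (s \<otimes> w) + 1"
      using left_descent_exists[OF c(2)] by blast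
    have su: "len u = len (s \<otimes> u) + 1" and swI: "s \<otimes> w \<in> right_weak_interval W S (s \<otimes> u)"
      using right_weak_interval_descent[OF s less.prems(1,3) sw] by auto
    note mult = right_weak_interval_S_mult[OF s less.prems(1) su]
    \<comment> \<open>Common to both cases: a chain from \<open>x\<close> to
      \<open>s \<otimes> w\<close> is multiplied by \<open>s\<close>, which lengthens every element
      of the smaller interval and hence keeps covers.\<close>
    have lift: "chain_in (right_weak_interval W S u) (s \<otimes> x) w"
      if x: "x \<in> right_weak_interval W S (s \<otimes> u)" "bruhat_le W S x (s \<otimes> w)" for x
    proof -
      have "chain_in (right_weak_interval W S (s \<otimes> u)) x (s \<otimes> w)"
        using less.hyps[of "s \<otimes> w" "s \<otimes> u" x] x swI sw s less.prems by (simp add: S_carrier)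
      then have "chain_in (right_weak_interval W S u) (s \<otimes> x) (s \<otimes> (s \<otimes> w))"
        by (rule chain_in_image) (simp_all add: mult bruhat_cover_S_mult[OF s])
      then show ?thesis using S_cancel[OF s c(2)] by simp
    qed
    have le: "bruhat_le W S (if len (s \<otimes> v) < len v then s \<otimes> v else v) (s \<otimes> w)"
      using lifting[OF less.prems(4) s c(2)] sw by simp
    consider "len v = len (s \<otimes> v) + 1" | "len (s \<otimes> v) = len v + 1"
      using len_S_mult[OF s c(1)] by blast
    then show ?thesis
    proof cases
      case 1
      then have "s \<otimes> v \<in> right_weak_interval W S (s \<otimes> u)"
        using right_weak_interval_descent[OF s less.prems(1,2)] by blast
      from lift[OF this] 1 le show ?thesis using S_cancel[OF s c(1)] by simp
    next
      case 2
      then have "v \<in> right_weak_interval W S (s \<otimes> u)"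
        using right_weak_interval_non_descent[OF s less.prems(1) su less.prems(2)] by blast
      from lift[OF this] 2 le have "chain_in (right_weak_interval W S u) (s \<otimes> v) w" by simp
      \<comment> \<open>The lifted chain starts at \<open>s \<otimes> v\<close>, so one more cover
        is put in front to reach \<open>v\<close>.\<close>
      moreover have "bruhat_cover W S v (s \<otimes> v)"
        using bruhat_step_S[OF s c(1)] 2 by (intro bruhat_coverI) auto
      ultimately show ?thesis by (rule chain_in_Cons[OF _ less.prems(2)])
    qed
  qed
qed

section \<open>Transfer to left weak intervals by inversion\<close>

text \<open>Inversion preserves length and turns right multiplication by the involution
  \<open>t\<close> into left multiplication.\<close>

lemma bruhat_step_inv:
  assumes "bruhat_step W S x y" shows "bruhat_step W S (inv x) (inv y)"
proof -
  obtain t where t: "t \<in> reflections W S" "x \<in> carrier W" "y \<in> carrier W" "y = x \<otimes> t"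
    "len x < len y" using assms by (rule bruhat_stepE)
  have "inv t = t" using reflection_square[OF t(1)] reflection_carrier[OF t(1)]
    by (simp add: inv_equality)
  then have "inv y = t \<otimes> inv x" using t by (simp add: inv_mult_group reflection_carrier)
  moreover have "len (inv x) < len (inv y)" using t(2,3,5) by simp
  ultimately show ?thesis unfolding bruhat_step_iff_left using t(1,2) by auto
qed

lemma bruhat_le_inv: "bruhat_le W S x y \<Longrightarrow> bruhat_le W S (inv x) (inv y)"
  unfolding bruhat_le_def
  by (induction rule: rtranclp_induct) (auto intro: rtranclp.rtrancl_into_rtrancl bruhat_step_inv)

lemma bruhat_cover_inv:
  assumes "bruhat_cover W S x y" shows "bruhat_cover W S (inv x) (inv y)"
proof -
  have "bruhat_step W S x y" by (rule bruhat_cover_step[OF assms])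
  then have "x \<in> carrier W" "y \<in> carrier W" by (auto elim: bruhat_stepE)
  with bruhat_step_inv[OF \<open>bruhat_step W S x y\<close>] assms show ?thesis
    by (intro bruhat_coverI) (auto simp: bruhat_cover_def)
qed

text \<open>The quotients of the two weak orders are inverse to each other, hence equally
  long.\<close>

lemma left_weak_interval_iff:
  assumes "u \<in> carrier W" "w \<in> carrier W"
  shows "w \<in> left_weak_interval W S u \<longleftrightarrow> inv w \<in> right_weak_interval W S (inv u)"
proof -
  have "inv (u \<otimes> inv w) = inv (inv w) \<otimes> inv u" using assms by (simp add: inv_mult_group)
  moreover have "len (inv (u \<otimes> inv w)) = len (u \<otimes> inv w)" using assms by simp
  ultimately show ?thesis using assms
    by (auto simp: left_weak_interval_def right_weak_interval_def left_weak_le_def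
        right_weak_le_def)
qed

lemma chain_property_right: "u \<in> carrier W \<Longrightarrow> chain_property W S (right_weak_interval W S u)"
  unfolding chain_property_iff using chain_in_right_weak_interval by blast

lemma chain_property_left:
  assumes u: "u \<in> carrier W" shows "chain_property W S (left_weak_interval W S u)"
  unfolding chain_property_iff
proof (intro ballI impI)
  fix v w
  assume v: "v \<in> left_weak_interval W S u" and w: "w \<in> left_weak_interval W S u"
    and le: "bruhat_le W S v w"
  have c: "v \<in> carrier W" "w \<in> carrier W" using v w by (auto simp: left_weak_interval_def)
  have "chain_in (right_weak_interval W S (inv u)) (inv v) (inv w)"
    using chain_in_right_weak_interval[of "inv u"] bruhat_le_inv[OF le] v w c u
    by (simp add: left_weak_interval_iff)
  then have "chain_in (left_weak_interval W S u) (inv (inv v)) (inv (inv w))"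
  proof (rule chain_in_image)
    fix x assume x: "x \<in> right_weak_interval W S (inv u)"
    then have "x \<in> carrier W" by (simp add: right_weak_interval_def)
    with x show "inv x \<in> left_weak_interval W S u" using u by (simp add: left_weak_interval_iff)
  qed (rule bruhat_cover_inv)
  then show "chain_in (left_weak_interval W S u) v w" using c by simp
qed

end

theorem theorem3p16:
  fixes W :: "('a, 'b) monoid_scheme" and S :: "'a set" and u :: 'a
  assumes "coxeter_system W S"
    and "u \<in> carrier W"
  shows "chain_property W S (left_weak_interval W S u) \<and>
         chain_property W S (right_weak_interval W S u)"
proof -
  interpret coxeter_group W S by unfold_locales (rule assms(1))
  show ?thesis using chain_property_left chain_property_right assms(2) by blast
qed

end
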